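(* Let $H$ be a graph and $v$ a non-isolated vertex of $H$. Then $$I(\mathrm{Tr}(H,v),x)=(2x+1)\,I(H,x)+(x+x^2)\,I(H_v,x).$$
   Context: All graphs are finite, simple and undirected. For a graph $G$, $\alpha(G)$ is the maximum size of an independent set of $G$, and the independence polynomial of $G$ is $I(G,x)=\sum_{i=0}^{\alpha(G)}a_ix^i$, where $a_i$ is the number of independent sets of $G$ of size $i$ (the empty set is counted, so $a_0=1$). For a vertex $v$ of $H$, $H_v$ denotes the graph obtained from $H$ by deleting $v$ and all neighbors of $v$ (possibly the graph with no vertices, whose independence polynomial is $1$). Trung's construction: for a graph $H$ and a non-isolated vertex $v$ of $H$, the graph $\mathrm{Tr}(H,v)$ is obtained from $H$ by adding three new vertices $a,b,c$ and the following edges: $c$ is joined to $b$ and to every neighbor of $v$ in $H$; $b$ is joined to $a$; and $a$ is joined to $v$. *)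

theory Defs
  imports "Graph_Theory.Pair_Digraph" "HOL-Computational_Algebra.Polynomial"
begin

text \<open>
  A finite simple undirected graph is a \<^locale>\<open>pair_graph\<close>: a finite digraph with
  arcs given as pairs of vertices, symmetric and without loops. An edge joining \<open>u\<close> and \<open>w\<close>
  corresponds to the two arcs \<open>(u, w)\<close> and \<open>(w, u)\<close>.
\<close>

definition neighbors :: "'a pair_pre_digraph \<Rightarrow> 'a \<Rightarrow> 'a set" where
  "neighbors G v = {w. (v, w) \<in> parcs G}"

definition independent_set :: "'a pair_pre_digraph \<Rightarrow> 'a set \<Rightarrow> bool" where
  "independent_set G S \<longleftrightarrow> S \<subseteq> pverts G \<and> (\<forall>u\<in>S. \<forall>w\<in>S. (u, w) \<notin> parcs G)"

definition independence_number :: "'a pair_pre_digraph \<Rightarrow> nat" where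
  "independence_number G = Max (card ` {S. independent_set G S})"

definition independence_poly :: "'a pair_pre_digraph \<Rightarrow> int poly" where
  "independence_poly G =
     (\<Sum>i = 0..independence_number G. monom (int (card {S. independent_set G S \<and> card S = i})) i)"

definition delete_closed_neighborhood :: "'a pair_pre_digraph \<Rightarrow> 'a \<Rightarrow> 'a pair_pre_digraph" where
  "delete_closed_neighborhood G v =
     (let W = pverts G - ({v} \<union> neighbors G v)
      in \<lparr> pverts = W, parcs = parcs G \<inter> (W \<times> W) \<rparr>)"

text \<open>The constructor \<open>Old\<close> embeds the vertices of the given graph, so that the three added
  vertices are distinct from them and from each other.\<close>

datatype 'a trung_vertex = Old 'a | New_a | New_b | New_c

definition trung :: "'a pair_pre_digraph \<Rightarrow> 'a \<Rightarrow> 'a trung_vertex pair_pre_digraph" where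
  "trung H v =
     (let E = {(New_c, New_b), (New_b, New_a), (New_a, Old v)}
              \<union> {(New_c, Old w) | w. w \<in> neighbors H v}
      in \<lparr> pverts = Old ` pverts H \<union> {New_a, New_b, New_c},
           parcs = map_prod Old Old ` parcs H \<union> E \<union> E\<inverse> \<rparr>)"

lemma pair_graph_delete_closed_neighborhood:
  assumes "pair_graph H"
  shows "pair_graph (delete_closed_neighborhood H v)"
proof -
  interpret pair_graph H by fact
  have "sym (parcs H)"
    using pair_sym_arcs by (simp add: symmetric_def)
  then show ?thesis
    using pair_finite_verts pair_finite_arcs
    by unfold_locales
      (auto simp: delete_closed_neighborhood_def Let_def symmetric_def sym_def dest: pair_no_loops)
qed

lemma pair_graph_trung:
  assumes "pair_graph H" and "v \<in> pverts H"
  shows "pair_graph (trung H v)"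
proof -
  interpret pair_graph H by fact
  have s: "sym (parcs H)"
    using pair_sym_arcs by (simp add: symmetric_def)
  have fin: "finite {(New_c :: 'a trung_vertex, Old w) | w. w \<in> neighbors H v}"
    by (rule finite_subset[of _ "{New_c} \<times> Old ` pverts H"])
       (auto simp: neighbors_def dest: wellformed' intro: pair_finite_verts)
  have verts: "pverts (trung H v) = Old ` pverts H \<union> {New_a, New_b, New_c}"
    by (simp add: trung_def Let_def)
  define E :: "('a trung_vertex \<times> 'a trung_vertex) set" where
    "E = {(New_c, New_b), (New_b, New_a), (New_a, Old v)}
         \<union> {(New_c, Old w) | w. w \<in> neighbors H v}"
  have arcs: "parcs (trung H v) = map_prod Old Old ` parcs H \<union> E \<union> E\<inverse>"
    by (simp add: trung_def Let_def E_def)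
  have nbr: "neighbors H v \<subseteq> pverts H"
    unfolding neighbors_def using wellformed' by blast
  have E: "E \<subseteq> pverts (trung H v) \<times> pverts (trung H v)" "\<And>x. (x, x) \<notin> E"
    using assms(2) nbr unfolding E_def verts by blast+
  have "finite E"
    using fin by (simp add: E_def)
  have "sym (map_prod Old Old ` parcs H)"
    using s unfolding sym_def by auto
  moreover have "sym (E \<union> E\<inverse>)"
    by (rule sym_Un_converse)
  ultimately have "sym (parcs (trung H v))"
    unfolding arcs Un_assoc by (rule sym_Un)
  moreover have "parcs (trung H v) \<subseteq> pverts (trung H v) \<times> pverts (trung H v)"
    using E(1) wellformed' unfolding arcs verts by fast
  moreover have "\<And>x. (x, x) \<notin> parcs (trung H v)"
    using E(2) pair_no_loops unfolding arcs by fastforce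
  moreover have "finite (pverts (trung H v))" "finite (parcs (trung H v))"
    using pair_finite_verts pair_finite_arcs \<open>finite E\<close> by (simp_all add: verts arcs)
  ultimately show ?thesis
    by unfold_locales (auto simp: symmetric_def)
qed

end

theory Submission
  imports Defs
begin

text \<open>
  The polynomial \<open>I(G, x)\<close> is the sum of \<open>x ^ card S\<close> over the independent sets \<open>S\<close> of \<open>G\<close>. An
  independent set of \<open>Tr(H, v)\<close> consists of an independent set \<open>S\<close> of \<open>H\<close> and an independent set
  of the path \<open>a - b - c\<close>, that is, one of \<open>\<emptyset>\<close>, \<open>{a}\<close>, \<open>{b}\<close>, \<open>{c}\<close>, \<open>{a, c}\<close>. The presence of \<open>a\<close>
  forbids \<open>v \<in> S\<close>, the presence of \<open>c\<close> forbids that \<open>S\<close> meets \<open>N(v)\<close>, and \<open>b\<close> forbids nothing in \<open>H\<close>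
  (\<open>independent_set_trung_iff\<close>). Let \<open>A\<close> and \<open>C\<close> be the generating functions of the independent sets
  of \<open>H\<close> that avoid \<open>v\<close> and of those that avoid \<open>N(v)\<close>. The sets with both properties are
  the independent sets of \<open>H\<^sub>v\<close>, so the five choices contribute
  \<open>I(H) + x A + x I(H) + x C + x\<^sup>2 I(H\<^sub>v)\<close>.
  An independent set that contains \<open>v\<close> avoids \<open>N(v)\<close>, so every independent set of \<open>H\<close> is counted in
  \<open>A\<close> or in \<open>C\<close>, and inclusion-exclusion gives \<open>A + C = I(H) + I(H\<^sub>v)\<close>, whence the identity.
\<close>

text \<open>Summing over sets rather than over sizes makes a partition of the independent sets into a
  sum of polynomials, with no reference to the independence number.\<close>

lemma independence_poly_eq_sum:
  assumes "finite (pverts G)"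
  shows "independence_poly G = (\<Sum>S | independent_set G S. monom 1 (card S))"
proof -
  let ?I = "{S. independent_set G S}"
  have fin: "finite ?I"
    by (rule finite_subset[of _ "Pow (pverts G)"]) (auto simp: independent_set_def assms)
  have "(\<Sum>S\<in>?I. monom 1 (card S))
      = (\<Sum>i = 0..independence_number G. \<Sum>S | S \<in> ?I \<and> card S = i. monom (1::int) (card S))"
    using fin by (intro sum.group[symmetric]) (auto simp: independence_number_def)
  also have "\<dots> = independence_poly G"
    unfolding independence_poly_def
    by (intro sum.cong) (auto simp: of_nat_monom smult_monom of_nat_poly monom_altdef)
  finally show ?thesis by simp
qed

lemma parcs_trung_iff:
  assumes "sym (parcs H)"
  shows "(Old u, Old w) \<in> parcs (trung H v) \<longleftrightarrow> (u, w) \<in> parcs H"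
    and "(New_a, Old w) \<in> parcs (trung H v) \<longleftrightarrow> w = v"
    and "(Old w, New_a) \<in> parcs (trung H v) \<longleftrightarrow> w = v"
    and "(New_b, Old w) \<notin> parcs (trung H v)"
    and "(Old w, New_b) \<notin> parcs (trung H v)"
    and "(New_c, Old w) \<in> parcs (trung H v) \<longleftrightarrow> w \<in> neighbors H v"
    and "(Old w, New_c) \<in> parcs (trung H v) \<longleftrightarrow> w \<in> neighbors H v"
    and "(New_a, New_b) \<in> parcs (trung H v)" "(New_b, New_a) \<in> parcs (trung H v)"
    and "(New_b, New_c) \<in> parcs (trung H v)" "(New_c, New_b) \<in> parcs (trung H v)"
    and "(New_a, New_c) \<notin> parcs (trung H v)" "(New_c, New_a) \<notin> parcs (trung H v)"
    and "(New_a, New_a) \<notin> parcs (trung H v)" "(New_b, New_b) \<notin> parcs (trung H v)"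
    and "(New_c, New_c) \<notin> parcs (trung H v)"
  by (auto simp: trung_def Let_def)

lemma independent_set_trung_iff:
  assumes "sym (parcs H)" and M: "M \<subseteq> {New_a, New_b, New_c}"
  shows "independent_set (trung H v) (Old ` S \<union> M) \<longleftrightarrow>
           M \<in> {{}, {New_a}, {New_b}, {New_c}, {New_a, New_c}} \<and> independent_set H S \<and>
           (New_a \<in> M \<longrightarrow> v \<notin> S) \<and> (New_c \<in> M \<longrightarrow> S \<inter> neighbors H v = {})"
proof -
  have ball_M: "(\<forall>u\<in>M. P u) \<longleftrightarrow>
      (New_a \<in> M \<longrightarrow> P New_a) \<and> (New_b \<in> M \<longrightarrow> P New_b) \<and> (New_c \<in> M \<longrightarrow> P New_c)" for P
    using M by blast
  have verts: "Old ` S \<union> M \<subseteq> pverts (trung H v) \<longleftrightarrow> S \<subseteq> pverts H"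
    using M by (auto simp: trung_def Let_def)
  have path: "M \<in> {{}, {New_a}, {New_b}, {New_c}, {New_a, New_c}} \<longleftrightarrow>
      \<not> (New_a \<in> M \<and> New_b \<in> M) \<and> \<not> (New_b \<in> M \<and> New_c \<in> M)"
  proof
    assume "\<not> (New_a \<in> M \<and> New_b \<in> M) \<and> \<not> (New_b \<in> M \<and> New_c \<in> M)"
    then have "M = (if New_b \<in> M then {New_b} else if New_a \<in> M
        then if New_c \<in> M then {New_a, New_c} else {New_a}
        else if New_c \<in> M then {New_c} else {})"
      using M by (auto split: if_splits)
    then show "M \<in> {{}, {New_a}, {New_b}, {New_c}, {New_a, New_c}}"
      by (metis insertCI)
  qed auto
  show ?thesis
    unfolding path unfolding independent_set_def verts ball_Un ball_M ball_simps
    by (simp add: parcs_trung_iff[OF assms(1)] disjoint_iff) blast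
qed

text \<open>The sets on the left are exactly those on which \<open>a\<close> and \<open>c\<close> may both be added.\<close>

lemma independent_set_delete_closed_neighborhood_iff:
  "independent_set (delete_closed_neighborhood H v) S \<longleftrightarrow>
     independent_set H S \<and> v \<notin> S \<and> S \<inter> neighbors H v = {}"
  by (auto simp: independent_set_def delete_closed_neighborhood_def Let_def)

theorem theorem3p6:
  fixes H :: "'a pair_pre_digraph" and v :: 'a
  assumes "pair_graph H"
    and "v \<in> pverts H"
    and "neighbors H v \<noteq> {}"
  shows "independence_poly (trung H v) =
           [:1, 2:] * independence_poly H
           + [:0, 1, 1:] * independence_poly (delete_closed_neighborhood H v)"
proof -
  interpret pair_graph H by fact
  let ?D = "delete_closed_neighborhood H v"
  have sym: "sym (parcs H)"
    using pair_sym_arcs by (simp add: symmetric_def)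
  define Ind where "Ind = {S. independent_set H S}"
  define avoid_v where "avoid_v = {S \<in> Ind. v \<notin> S}"
  define avoid_nbrs where "avoid_nbrs = {S \<in> Ind. S \<inter> neighbors H v = {}}"
  define gf :: "'a set set \<Rightarrow> int poly" where "gf F = (\<Sum>S\<in>F. monom 1 (card S))" for F
  define New :: "'a trung_vertex set set"
    where "New = {{}, {New_a}, {New_b}, {New_c}, {New_a, New_c}}"
  define F where "F M = {S \<in> Ind. (New_a \<in> M \<longrightarrow> v \<notin> S) \<and>
      (New_c \<in> M \<longrightarrow> S \<inter> neighbors H v = {})}" for M :: "'a trung_vertex set"
  let ?join = "\<lambda>(M, S). Old ` S \<union> M"

  have finS: "finite S" if "S \<in> Ind" for S
    using that pair_finite_verts by (auto simp: Ind_def independent_set_def intro: finite_subset)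
  have finInd: "finite Ind"
    by (rule finite_subset[of _ "Pow (pverts H)"])
       (auto simp: Ind_def independent_set_def pair_finite_verts)
  have finF: "finite (F M)" for M
    using finInd by (simp add: F_def)
  have New_sub: "M \<subseteq> {New_a, New_b, New_c}" if "M \<in> New" for M
    using that by (auto simp: New_def)
  have finM: "finite M" if "M \<in> New" for M
    using New_sub[OF that] by (rule finite_subset) simp

  have Ind_trung: "{T. independent_set (trung H v) T} = ?join ` (SIGMA M:New. F M)"
  proof (intro equalityI subsetI)
    fix T assume T: "T \<in> {T. independent_set (trung H v) T}"
    define S where "S = Old -` T"
    define M where "M = T \<inter> {New_a, New_b, New_c}"
    have "T \<subseteq> Old ` pverts H \<union> {New_a, New_b, New_c}"
      using T by (simp add: independent_set_def trung_def Let_def)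
    moreover have M_sub: "M \<subseteq> {New_a, New_b, New_c}"
      by (simp add: M_def)
    ultimately have T_eq: "T = Old ` S \<union> M"
      by (auto simp: S_def M_def)
    have "(M, S) \<in> (SIGMA M:New. F M)"
      using T independent_set_trung_iff[OF sym, of M v S] M_sub
      unfolding T_eq New_def F_def Ind_def by simp
    then show "T \<in> ?join ` (SIGMA M:New. F M)"
      by (rule rev_image_eqI) (simp add: T_eq)
  next
    fix T assume "T \<in> ?join ` (SIGMA M:New. F M)"
    then obtain M S where "T = Old ` S \<union> M" "M \<in> New" "S \<in> F M"
      by auto
    then show "T \<in> {T. independent_set (trung H v) T}"
      using independent_set_trung_iff[OF sym New_sub[of M], of v S]
      by (simp add: F_def New_def Ind_def)
  qed
  have inj: "inj_on ?join (SIGMA M:New. F M)"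
  proof (rule inj_on_inverseI[where g = "\<lambda>T. (T \<inter> {New_a, New_b, New_c}, Old -` T)"])
    fix p assume "p \<in> (SIGMA M:New. F M)"
    then show "(?join p \<inter> {New_a, New_b, New_c}, Old -` ?join p) = p"
      using New_sub by (cases p) fastforce
  qed
  have card_join: "card (Old ` S \<union> M) = card M + card S" if "M \<in> New" "S \<in> F M" for M S
  proof -
    have "card (Old ` S \<union> M) = card (Old ` S) + card M"
      using that New_sub[of M] finS finM by (intro card_Un_disjoint) (auto simp: F_def)
    also have "card (Old ` S) = card S"
      by (rule card_image) (simp add: inj_on_def)
    finally show ?thesis by simp
  qed

  have fin_trung: "finite (pverts (trung H v))"
    using pair_finite_verts by (simp add: trung_def Let_def)
  have F_simps: "F {} = Ind" "F {New_b} = Ind" "F {New_a} = avoid_v" "F {New_c} = avoid_nbrs"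
      "F {New_a, New_c} = avoid_v \<inter> avoid_nbrs"
    by (auto simp: F_def avoid_v_def avoid_nbrs_def)
  have "independence_poly (trung H v)
      = (\<Sum>(M, S)\<in>(SIGMA M:New. F M). monom 1 (card (Old ` S \<union> M)))"
    unfolding independence_poly_eq_sum[OF fin_trung] Ind_trung sum.reindex[OF inj]
    by (simp add: case_prod_unfold)
  also have "\<dots> = (\<Sum>M\<in>New. \<Sum>S\<in>F M. monom 1 (card (Old ` S \<union> M)))"
    using finF by (subst sum.Sigma) (auto simp: New_def)
  also have "\<dots> = (\<Sum>M\<in>New. monom 1 (card M) * gf (F M))"
    by (simp add: gf_def sum_distrib_left mult_monom card_join)
  also have "\<dots> = gf Ind + monom 1 1 * gf avoid_v + monom 1 1 * gf Ind
      + monom 1 1 * gf avoid_nbrs + monom 1 2 * gf (avoid_v \<inter> avoid_nbrs)"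
    by (simp add: New_def F_simps insert_eq_iff doubleton_eq_iff numeral_2_eq_2)
  finally have trung_eq: "independence_poly (trung H v)
      = gf Ind + [:0, 1:] * (gf avoid_v + gf avoid_nbrs) + [:0, 1:] * gf Ind
        + [:0, 0, 1:] * gf (avoid_v \<inter> avoid_nbrs)"
    by (simp add: monom_altdef power2_eq_square algebra_simps)

  have cover: "avoid_v \<union> avoid_nbrs = Ind"
    by (auto simp: avoid_v_def avoid_nbrs_def Ind_def independent_set_def neighbors_def)
  have "gf avoid_v + gf avoid_nbrs = gf Ind + gf (avoid_v \<inter> avoid_nbrs)"
    using sum.union_inter[of avoid_v avoid_nbrs "\<lambda>S. monom 1 (card S) :: int poly"] finInd
    unfolding gf_def cover by (simp add: avoid_v_def avoid_nbrs_def)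
  moreover have "independence_poly H = gf Ind"
    using pair_finite_verts by (simp add: independence_poly_eq_sum gf_def Ind_def)
  moreover have "independence_poly ?D = gf (avoid_v \<inter> avoid_nbrs)"
  proof -
    have "finite (pverts ?D)"
      using pair_finite_verts by (simp add: delete_closed_neighborhood_def Let_def)
    moreover have "{S. independent_set ?D S} = avoid_v \<inter> avoid_nbrs"
      by (auto simp: independent_set_delete_closed_neighborhood_iff Ind_def avoid_v_def
          avoid_nbrs_def)
    ultimately show ?thesis
      by (simp add: independence_poly_eq_sum gf_def)
  qed
  ultimately have "independence_poly (trung H v)
      = (1 + [:0, 1:] + [:0, 1:]) * independence_poly H
        + ([:0, 1:] + [:0, 0, 1:]) * independence_poly ?D"
    unfolding trung_eq by (simp only: algebra_simps mult_1_left mult_1_right)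
  also have "1 + [:0, 1:] + [:0, 1:] = [:1, 2 :: int:]"
    by (simp add: one_pCons)
  also have "[:0, 1:] + [:0, 0, 1:] = [:0, 1, 1 :: int:]"
    by simp
  finally show ?thesis .
qed

end
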